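(* Let $G$ be a finite simple undirected graph with maximum degree $\Delta(G) \ge 9$ such that for every vertex $u \in V(G)$, every $v \in N(u)$ is non-adjacent to at most three vertices of $N(u)$ (other than $v$ itself). Then $\chi(G) \le \max\{\Delta(G)-1, \omega(G)\}$.
   Context: All graphs are finite, simple and undirected. For a graph $G$: $V(G)$ is the vertex set, $\Delta(G)$ the maximum degree, $\omega(G)$ the size of a maximum clique, $\chi(G)$ the chromatic number. For $u \in V(G)$, $N(u) = \{v \in V(G) : uv \in E(G)\}$ is the open neighbourhood of $u$. *)

theory Defs
  imports "Graph_Theory.Pair_Digraph"
begin

(* A finite simple undirected graph is a pair_graph: finitely many vertices and a symmetric,
   irreflexive set of ordered pairs of vertices. An edge uv is present as both (u, v) and (v, u). *)

definition nbhd :: "'a pair_pre_digraph \<Rightarrow> 'a \<Rightarrow> 'a set" where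
  "nbhd G u = {v \<in> pverts G. (u, v) \<in> parcs G}"

definition degree :: "'a pair_pre_digraph \<Rightarrow> 'a \<Rightarrow> nat" where
  "degree G u = card (nbhd G u)"

(* Inserting 0 only fixes the value for the graph without vertices. *)
definition max_degree :: "'a pair_pre_digraph \<Rightarrow> nat" where
  "max_degree G = Max (insert 0 (degree G ` pverts G))"

definition is_clique :: "'a pair_pre_digraph \<Rightarrow> 'a set \<Rightarrow> bool" where
  "is_clique G K \<longleftrightarrow> K \<subseteq> pverts G \<and> (\<forall>u\<in>K. \<forall>v\<in>K. u \<noteq> v \<longrightarrow> (u, v) \<in> parcs G)"

definition clique_number :: "'a pair_pre_digraph \<Rightarrow> nat" where
  "clique_number G = Max {card K |K. is_clique G K}"

definition is_coloring :: "'a pair_pre_digraph \<Rightarrow> nat \<Rightarrow> ('a \<Rightarrow> nat) \<Rightarrow> bool" where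
  "is_coloring G k c \<longleftrightarrow>
     (\<forall>v\<in>pverts G. c v < k) \<and> (\<forall>(u, v)\<in>parcs G. c u \<noteq> c v)"

definition chromatic_number :: "'a pair_pre_digraph \<Rightarrow> nat" where
  "chromatic_number G = (LEAST k. \<exists>c. is_coloring G k c)"

lemma degree_eq_out_degree:
  assumes "pair_graph G"
  shows "degree G u = out_degree (with_proj G) u"
proof -
  interpret pair_graph G by fact
  have "out_arcs (with_proj G) u = Pair u ` nbhd G u"
    by (auto simp: out_arcs_def nbhd_def dest: in_arcsD2)
  then show ?thesis
    by (simp add: degree_def out_degree_def card_image inj_on_def)
qed

lemma max_degree_witness:
  assumes "pair_graph G" "pverts G \<noteq> {}"
  shows "\<exists>u\<in>pverts G. degree G u = max_degree G"
    and "u \<in> pverts G \<Longrightarrow> degree G u \<le> max_degree G"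
proof -
  interpret pair_graph G by fact
  have "max_degree G = Max (degree G ` pverts G)"
    using assms(2) pair_finite_verts by (simp add: max_degree_def)
  moreover have "Max (degree G ` pverts G) \<in> degree G ` pverts G"
    using assms(2) pair_finite_verts by (intro Max_in) auto
  ultimately show "\<exists>u\<in>pverts G. degree G u = max_degree G" by auto
  show "u \<in> pverts G \<Longrightarrow> degree G u \<le> max_degree G"
    using pair_finite_verts by (auto simp: max_degree_def intro!: Max_ge)
qed

lemma clique_number_witness:
  assumes "pair_graph G"
  shows "\<exists>K. is_clique G K \<and> card K = clique_number G"
    and "is_clique G K \<Longrightarrow> card K \<le> clique_number G"
proof -
  interpret pair_graph G by fact
  have "{card K |K. is_clique G K} \<subseteq> card ` Pow (pverts G)"
    by (auto simp: is_clique_def)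
  then have fin: "finite {card K |K. is_clique G K}"
    by (rule finite_subset) (simp add: pair_finite_verts)
  have "is_clique G {}" by (simp add: is_clique_def)
  then have "clique_number G \<in> {card K |K. is_clique G K}"
    unfolding clique_number_def by (intro Max_in fin) auto
  then show "\<exists>K. is_clique G K \<and> card K = clique_number G" by auto
  show "is_clique G K \<Longrightarrow> card K \<le> clique_number G"
    unfolding clique_number_def by (intro Max_ge fin) auto
qed

lemma chromatic_number_witness:
  assumes "pair_graph G"
  shows "\<exists>c. is_coloring G (chromatic_number G) c"
    and "is_coloring G k c \<Longrightarrow> chromatic_number G \<le> k"
proof -
  interpret pair_graph G by fact
  obtain h :: "'a \<Rightarrow> nat" where h: "bij_betw h (pverts G) {0..<card (pverts G)}"
    using ex_bij_betw_finite_nat[OF pair_finite_verts] by auto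
  have "h v < card (pverts G)" if "v \<in> pverts G" for v
    using bij_betwE[OF h] that by simp
  moreover have "h u \<noteq> h v" if uv: "(u, v) \<in> parcs G" for u v
  proof -
    have "u \<noteq> v" using pair_no_loops[OF uv] by simp
    with inj_on_contraD[OF bij_betw_imp_inj_on[OF h]] in_arcsD1[OF uv] in_arcsD2[OF uv]
    show ?thesis by blast
  qed
  ultimately have "is_coloring G (card (pverts G)) h"
    by (simp add: is_coloring_def split_beta)
  then have "\<exists>k c. is_coloring G k c" by blast
  then show "\<exists>c. is_coloring G (chromatic_number G) c"
    unfolding chromatic_number_def by (rule LeastI_ex)
  show "is_coloring G k c \<Longrightarrow> chromatic_number G \<le> k"
    unfolding chromatic_number_def by (rule Least_le) blast
qed

end

theory Submission
  imports Defs
begin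

text \<open>
  Put \<open>k = max (\<Delta> - 1) \<omega>\<close>; then \<open>k \<ge> 8\<close>, all degrees are at most \<open>k + 1\<close>, no clique has more than
  \<open>k\<close> vertices, and these bounds together with the condition on neighbourhoods pass to induced
  subgraphs. It suffices to \<open>k\<close>-colour every such graph (\<open>colourable\<close>), by induction on the vertex
  set: remove a vertex \<open>u\<close> of maximum degree, take a \<open>k\<close>-colouring \<open>\<phi>\<close> of the rest, and suppose that
  no \<open>k\<close>-colouring of the whole graph exists. Write \<open>H\<close> for the neighbourhood of \<open>u\<close>. All \<open>k\<close> colours
  occur on \<open>H\<close>, and \<open>H\<close> has at most \<open>k + 1\<close> vertices, so at most one colour occurs twice on \<open>H\<close>.

  Only \<open>H\<close> and \<open>u\<close> are ever recoloured. A vertex \<open>w\<close> of \<open>H\<close> must then avoid the colours \<open>F w\<close> of its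
  neighbours outside \<open>H\<close> and \<open>u\<close>. As \<open>u\<close> has maximum degree, \<open>w\<close> has at most as many such neighbours
  as it has non-neighbours in \<open>H\<close> (the set \<open>M w\<close>), hence \<open>card (F w) \<le> card (M w) \<le> 3\<close>. If \<open>H\<close> is
  partitioned into \<open>k - 1\<close> independent classes, the classes cannot receive distinct permitted colours,
  as a colour would remain for \<open>u\<close>. By Hall's theorem there are a set \<open>S\<close> of classes and a set \<open>T\<close> of
  colours forbidden on every class of \<open>S\<close>, with \<open>card S + card T > k\<close> (\<open>blocked\<close>). A class with a
  single vertex is denied at most three colours, so \<open>S\<close> contains almost all of the classes.

  Let two non-adjacent vertices \<open>x\<close>, \<open>y\<close>, each the only one of its colour in \<open>H\<close>, be merged into one
  class. Comparison with \<open>\<phi>\<close> shows that \<open>T\<close> contains \<open>\<phi> x\<close> and \<open>\<phi> y\<close>: nearly every other uniquely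
  coloured vertex has both colours among its at most three forbidden ones (\<open>merge\<close>). These vertices
  have few forbidden colours to spare, which prevents further non-adjacent pairs from being
  obstructed in the same way, yet having many forbidden colours they need many non-neighbours in \<open>H\<close>.
  So the set \<open>X\<close> of uniquely coloured vertices is a clique (\<open>X_clique\<close>). If \<open>X = H\<close>, adding \<open>u\<close> gives a
  clique of size \<open>k + 1\<close>. Otherwise \<open>H\<close> is \<open>X\<close> together with a non-adjacent pair \<open>p\<close>, \<open>q\<close>, and merging
  \<open>p\<close> and \<open>q\<close> with non-neighbours in \<open>X\<close> leaves a partition that cannot be blocked
  (\<open>no_merge_with_pair\<close>). Hence one of \<open>p\<close>, \<open>q\<close> is adjacent to all of \<open>X\<close>, which again gives a clique
  of size \<open>k + 1\<close> (\<open>large_clique\<close>).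
\<close>

section \<open>Systems of distinct representatives\<close>

text \<open>
  Hall's theorem, by the argument of Halmos and Vaughan. If some proper part \<open>J\<close> of the index set has
  exactly as many elements available as it needs, \<open>J\<close> and its complement are served separately.
  Otherwise there is one element to spare everywhere, and any choice for a first index can be made.
\<close>

lemma distinct_representatives:
  fixes A :: "'i \<Rightarrow> 'c set"
  assumes "finite I" and "\<And>i. i \<in> I \<Longrightarrow> finite (A i)"
    and "\<And>J. J \<subseteq> I \<Longrightarrow> card J \<le> card (\<Union>(A ` J))"
  shows "\<exists>g. inj_on g I \<and> (\<forall>i\<in>I. g i \<in> A i)"
  using assms
proof (induction "card I" arbitrary: I A rule: less_induct)
  case less
  note fin = less.prems(1) and finA = less.prems(2) and hall = less.prems(3)
  show ?case
  proof (cases "\<exists>J. J \<subset> I \<and> J \<noteq> {} \<and> card (\<Union>(A ` J)) = card J")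
    case True
    then obtain J where J: "J \<subset> I" "J \<noteq> {}" and tight: "card (\<Union>(A ` J)) = card J"
      by blast
    define U where "U = \<Union>(A ` J)"
    have finJ: "finite J" using J fin finite_subset by blast
    have finU: "finite U" using finJ J finA by (auto simp: U_def)
    have "card J < card I" using J fin by (simp add: psubset_card_mono)
    then have "\<exists>g. inj_on g J \<and> (\<forall>i\<in>J. g i \<in> A i)"
      using J finA hall finJ by (intro less.hyps) auto
    then obtain g where g: "inj_on g J" "\<And>i. i \<in> J \<Longrightarrow> g i \<in> A i" by blast
    have "card (I - J) < card I"
      using J fin by (intro psubset_card_mono) auto
    moreover have "card K \<le> card (\<Union>i\<in>K. A i - U)" if K: "K \<subseteq> I - J" for K
    proof -
      have finK: "finite K" using K fin finite_subset by blast
      have fK: "finite (\<Union>i\<in>K. A i - U)" using finK K finA by auto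
      have "card J + card K = card (J \<union> K)"
        using K finJ finK by (subst card_Un_disjoint) auto
      also have "\<dots> \<le> card (\<Union>(A ` (J \<union> K)))" using K J by (intro hall) auto
      also have "\<Union>(A ` (J \<union> K)) = U \<union> (\<Union>i\<in>K. A i - U)" by (auto simp: U_def)
      also have "card \<dots> = card U + card (\<Union>i\<in>K. A i - U)"
        using finU fK by (intro card_Un_disjoint) auto
      finally show ?thesis using tight by (simp add: U_def)
    qed
    ultimately have "\<exists>g. inj_on g (I - J) \<and> (\<forall>i\<in>I - J. g i \<in> A i - U)"
      using fin finA by (intro less.hyps) auto
    then obtain h where h: "inj_on h (I - J)" "\<And>i. i \<in> I - J \<Longrightarrow> h i \<in> A i - U" by blast
    have gU: "g i \<in> U" if "i \<in> J" for i using g(2)[OF that] that by (auto simp: U_def)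
    define r where "r i = (if i \<in> J then g i else h i)" for i
    have "inj_on r I"
    proof (rule inj_onI)
      fix i j assume ij: "i \<in> I" "j \<in> I" "r i = r j"
      show "i = j"
        using ij gU[of i] gU[of j] h(2)[of i] h(2)[of j] inj_onD[OF g(1), of i j] inj_onD[OF h(1), of i j]
        by (cases "i \<in> J"; cases "j \<in> J") (auto simp: r_def)
    qed
    moreover have "r i \<in> A i" if "i \<in> I" for i
      using that g(2) h(2) by (auto simp: r_def)
    ultimately show ?thesis by blast
  next
    case False
    show ?thesis
    proof (cases "I = {}")
      case True
      then show ?thesis by simp
    next
      case ne: False
      then obtain i where i: "i \<in> I" by blast
      have "card {i} \<le> card (\<Union>(A ` {i}))" using i by (intro hall) auto
      then have "A i \<noteq> {}" by auto
      then obtain a where a: "a \<in> A i" by blast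
      have "card (I - {i}) < card I" using i fin by (intro psubset_card_mono) auto
      moreover have "card K \<le> card (\<Union>j\<in>K. A j - {a})" if K: "K \<subseteq> I - {i}" for K
      proof (cases "K = {}")
        case neK: False
        have "card K \<noteq> card (\<Union>(A ` K))" using False neK K i by (metis Diff_iff insertI1 psubsetI subset_Diff_insert subset_iff)
        moreover have "card K \<le> card (\<Union>(A ` K))" using K by (intro hall) auto
        moreover have "(\<Union>j\<in>K. A j - {a}) = \<Union>(A ` K) - {a}" by auto
        moreover have "card (\<Union>(A ` K)) - 1 \<le> card (\<Union>(A ` K) - {a})"
          by (simp add: card_Diff_singleton_if)
        ultimately show ?thesis by simp
      qed auto
      ultimately have "\<exists>g. inj_on g (I - {i}) \<and> (\<forall>j\<in>I - {i}. g j \<in> A j - {a})"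
        using fin finA by (intro less.hyps) auto
      then obtain g where g: "inj_on g (I - {i})" "\<And>j. j \<in> I - {i} \<Longrightarrow> g j \<in> A j - {a}"
        by blast
      have "inj_on (g(i := a)) I"
        using g by (auto simp: inj_on_def)
      moreover have "\<forall>j\<in>I. (g(i := a)) j \<in> A j" using g a by auto
      ultimately show ?thesis by blast
    qed
  qed
qed

section \<open>Extending a partial colouring to one more vertex\<close>

definition proper :: "('a \<Rightarrow> 'a \<Rightarrow> bool) \<Rightarrow> 'a set \<Rightarrow> nat \<Rightarrow> ('a \<Rightarrow> nat) \<Rightarrow> bool" where
  "proper adj V k c \<longleftrightarrow>
     (\<forall>v\<in>V. c v < k) \<and> (\<forall>v\<in>V. \<forall>w\<in>V. adj v w \<longrightarrow> c v \<noteq> c w)"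

text \<open>
  The situation to be refuted in the induction step, except for the bound on cliques: the analysis
  ends by exhibiting a clique of size \<open>k + 1\<close>.
\<close>

locale stuck_vertex =
  fixes adj :: "'a \<Rightarrow> 'a \<Rightarrow> bool" and V :: "'a set" and u :: 'a and k :: nat
    and \<phi> :: "'a \<Rightarrow> nat"
  assumes fin: "finite V"
    and sym: "adj v w \<Longrightarrow> adj w v"
    and irr: "\<not> adj v v"
    and uV: "u \<in> V"
    and k8: "8 \<le> k"
    and deg_u: "card {v \<in> V. adj u v} \<le> k + 1"
    and deg_le: "w \<in> V \<Longrightarrow> card {v \<in> V. adj w v} \<le> card {v \<in> V. adj u v}"
    and codeg: "\<lbrakk>v \<in> V; adj u v\<rbrakk> \<Longrightarrow> card {w \<in> V. adj u w \<and> w \<noteq> v \<and> \<not> adj v w} \<le> 3"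
    and col: "proper adj (V - {u}) k \<phi>"
    and stuck: "\<nexists>c. proper adj V k c"
begin

definition H where "H = {v \<in> V. adj u v}"

definition M where "M w = {z \<in> H. z \<noteq> w \<and> \<not> adj w z}"

definition F where "F w = \<phi> ` {z \<in> V. adj w z \<and> z \<noteq> u \<and> z \<notin> H}"

definition X where "X = {w \<in> H. \<forall>z\<in>H. \<phi> z = \<phi> w \<longrightarrow> z = w}"

lemma finH: "finite H" using fin by (simp add: H_def)

lemma finF: "finite (F w)" using fin by (simp add: F_def)

lemma finM: "finite (M w)" using finH by (simp add: M_def)

lemma finX: "finite X" using finH by (simp add: X_def)

lemma XH: "X \<subseteq> H" by (auto simp: X_def)

lemma u_notin_H: "u \<notin> H" using irr by (simp add: H_def)

lemma M_le_3: "w \<in> H \<Longrightarrow> card (M w) \<le> 3"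
  using codeg[of w] by (simp add: H_def M_def conj_assoc)

lemma phi_less: "w \<in> H \<Longrightarrow> \<phi> w < k"
  using col irr by (auto simp: proper_def H_def)

lemma phi_notin_F:
  assumes "w \<in> H" shows "\<phi> w \<notin> F w"
  using assms col irr unfolding proper_def F_def H_def by fastforce

text \<open>
  Compare degrees: besides \<open>u\<close>, the vertex \<open>w\<close> is adjacent to all of \<open>H\<close> except itself and \<open>M w\<close>, and
  its degree is at most \<open>card H\<close>, so at most \<open>card (M w)\<close> neighbours lie elsewhere.
\<close>

lemma F_le_M:
  assumes w: "w \<in> H" shows "card (F w) \<le> card (M w)"
proof -
  define Z where "Z = {z \<in> V. adj w z \<and> z \<noteq> u \<and> z \<notin> H}"
  define B where "B = {z \<in> H. adj w z}"
  have wu: "adj w u" "w \<in> V" using w sym by (auto simp: H_def)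
  have fins: "finite Z" "finite B" using fin finH by (auto simp: Z_def B_def)
  have "{v \<in> V. adj w v} = insert u (Z \<union> B)"
    using wu uV by (auto simp: Z_def B_def H_def)
  moreover have "u \<notin> Z \<union> B" using u_notin_H by (auto simp: Z_def B_def)
  moreover have "card (Z \<union> B) = card Z + card B"
    using fins by (intro card_Un_disjoint) (auto simp: Z_def B_def)
  ultimately have "card {v \<in> V. adj w v} = 1 + (card Z + card B)" using fins by simp
  then have "1 + (card Z + card B) \<le> card H" using deg_le[OF wu(2)] by (simp add: H_def)
  moreover have "card H = 1 + (card B + card (M w))"
  proof -
    have "H = insert w (B \<union> M w)" using w by (auto simp: B_def M_def)
    moreover have "w \<notin> B \<union> M w" using irr by (simp add: B_def M_def)
    moreover have "card (B \<union> M w) = card B + card (M w)"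
      using fins finM by (intro card_Un_disjoint) (auto simp: B_def M_def)
    moreover have "finite (B \<union> M w)" using fins finM by simp
    ultimately show ?thesis by (metis card_insert_disjoint plus_1_eq_Suc)
  qed
  moreover have "card (F w) \<le> card Z" unfolding F_def Z_def[symmetric] using fins by (simp add: card_image_le)
  ultimately show ?thesis by simp
qed

lemma F_le_3: "w \<in> H \<Longrightarrow> card (F w) \<le> 3"
  using F_le_M M_le_3 le_trans by blast

lemma all_colours: "\<phi> ` H = {..<k}"
proof
  show "\<phi> ` H \<subseteq> {..<k}" using phi_less by auto
  show "{..<k} \<subseteq> \<phi> ` H"
  proof (rule ccontr)
    assume "\<not> {..<k} \<subseteq> \<phi> ` H"
    then obtain c where c: "c < k" "c \<notin> \<phi> ` H" by auto
    have "proper adj V k (\<phi>(u := c))"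
      using col c irr sym unfolding proper_def H_def by (auto simp: image_iff)
    then show False using stuck by blast
  qed
qed

text \<open>
  The partition of \<open>H\<close> into classes is given by the fibres of a colouring \<open>\<rho>\<close> of \<open>H\<close> that omits the
  colour \<open>c0\<close> and disregards everything outside \<open>H\<close>. Renaming its colours injectively to ones that
  each fibre permits would leave a colour for \<open>u\<close>; so Hall's condition fails for some set \<open>S\<close> of
  fibres, and \<open>T\<close> consists of the colours that no fibre in \<open>S\<close> permits.
\<close>

lemma blocked:
  fixes \<rho> :: "'a \<Rightarrow> nat"
  defines "P \<equiv> \<lambda>c. {w \<in> H. \<rho> w = c}"
  assumes c0: "c0 < k"
    and range: "\<rho> ` H \<subseteq> {..<k} - {c0}"
    and indep: "\<And>v w. v \<in> H \<Longrightarrow> w \<in> H \<Longrightarrow> adj v w \<Longrightarrow> \<rho> v \<noteq> \<rho> w"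
  obtains S T where "S \<subseteq> {..<k} - {c0}" "T \<subseteq> {..<k}" "k < card S + card T"
    "\<And>c. c \<in> S \<Longrightarrow> T \<subseteq> \<Union>(F ` P c)"
proof -
  define I where "I = {..<k} - {c0}"
  define A where "A c = {..<k} - \<Union>(F ` P c)" for c
  have finI: "finite I" by (simp add: I_def)
  have cardI: "card I = k - 1" using c0 by (simp add: I_def)
  have \<rho>I: "\<rho> v \<in> I" if "v \<in> H" for v using that range by (auto simp: I_def)
  have "\<not> (\<forall>S. S \<subseteq> I \<longrightarrow> card S \<le> card (\<Union>(A ` S)))"
  proof
    assume "\<forall>S. S \<subseteq> I \<longrightarrow> card S \<le> card (\<Union>(A ` S))"
    then obtain g where g: "inj_on g I" "\<And>c. c \<in> I \<Longrightarrow> g c \<in> A c"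
      using distinct_representatives[of I A] finI by (auto simp: A_def)
    have "card (g ` I) < card {..<k}"
      using cardI k8 by (simp add: card_image[OF g(1)])
    then obtain e where e: "e < k" "e \<notin> g ` I"
      by (metis card_mono finite_imageI finI lessThan_iff linorder_not_less subsetI)
    define c where "c v = (if v \<in> H then g (\<rho> v) else if v = u then e else \<phi> v)" for v
    have diff: "c v \<noteq> c w" if vw: "v \<in> V" "w \<in> V" "adj v w" "v \<in> H \<or> w \<notin> H" for v w
    proof -
      consider "v \<in> H" "w \<in> H" | "v \<in> H" "w = u" | "v \<in> H" "w \<notin> H" "w \<noteq> u" | "v \<notin> H" "w \<notin> H"
        using vw(4) by blast
      then show ?thesis
      proof cases
        case 1
        then have "\<rho> v \<noteq> \<rho> w" using indep vw(3) by blast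
        then show ?thesis using inj_onD[OF g(1)] 1 \<rho>I by (auto simp: c_def)
      next
        case 2
        then show ?thesis using e \<rho>I u_notin_H by (auto simp: c_def)
      next
        case 3
        then have "\<phi> w \<in> F v" using vw by (auto simp: F_def)
        moreover have "g (\<rho> v) \<notin> F v" using g(2)[OF \<rho>I[OF 3(1)]] 3 by (auto simp: A_def P_def)
        ultimately show ?thesis using 3 by (auto simp: c_def)
      next
        case 4
        then have "v \<noteq> u" "w \<noteq> u" using vw sym by (auto simp: H_def)
        then show ?thesis using col vw 4 by (auto simp: c_def proper_def)
      qed
    qed
    have "proper adj V k c"
      unfolding proper_def
    proof (intro conjI ballI impI)
      fix v assume "v \<in> V"
      show "c v < k"
      proof (cases "v \<in> H")
        case True
        then show ?thesis using g(2)[OF \<rho>I] by (auto simp: c_def A_def)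
      next
        case False
        then show ?thesis using \<open>v \<in> V\<close> e col by (auto simp: c_def proper_def)
      qed
    next
      fix v w assume "v \<in> V" "w \<in> V" "adj v w"
      then show "c v \<noteq> c w" using diff[of v w] diff[of w v] sym by metis
    qed
    then show False using stuck by blast
  qed
  then obtain S where S: "S \<subseteq> I" "card (\<Union>(A ` S)) < card S" by auto
  define T where "T = {..<k} - \<Union>(A ` S)"
  have "\<Union>(A ` S) \<subseteq> {..<k}" by (auto simp: A_def)
  then have "card T = k - card (\<Union>(A ` S))" "card (\<Union>(A ` S)) \<le> k"
    using card_mono[of "{..<k}" "\<Union>(A ` S)"] by (auto simp: T_def card_Diff_subset finite_subset)
  then have "k < card S + card T" using S(2) by simp
  moreover have "T \<subseteq> \<Union>(F ` P c)" if "c \<in> S" for c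
    using that by (auto simp: T_def A_def)
  ultimately show ?thesis using that[of S T] S(1) by (auto simp: T_def I_def)
qed

section \<open>The uniquely coloured neighbours form a clique\<close>

text \<open>At most \<open>k + 1\<close> vertices of \<open>H\<close> carry all \<open>k\<close> colours, so at most one colour is repeated.\<close>

lemma unique_or_pair:
  obtains "X = H" | p q where "p \<noteq> q" "p \<in> H" "q \<in> H" "\<phi> p = \<phi> q" "H - X = {p, q}" "card H = k + 1"
proof (cases "inj_on \<phi> H")
  case True
  then have "X = H" by (auto simp: X_def inj_on_def)
  then show ?thesis using that by blast
next
  case False
  then obtain p q where pq: "p \<in> H" "q \<in> H" "p \<noteq> q" "\<phi> p = \<phi> q" by (auto simp: inj_on_def)
  have "\<phi> q \<in> \<phi> ` (H - {q})" using pq by (intro image_eqI[of _ _ p]) auto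
  moreover have "\<phi> ` H = insert (\<phi> q) (\<phi> ` (H - {q}))" using pq(2) by blast
  ultimately have im: "\<phi> ` (H - {q}) = {..<k}" using all_colours by (simp add: insert_absorb)
  have cH: "card H \<le> k + 1" using deg_u by (simp add: H_def)
  have "card (H - {q}) \<ge> k" using im finH card_image_le[of "H - {q}" \<phi>] by simp
  then have c1: "card (H - {q}) = k" "card H = k + 1" using cH pq finH k8 by auto
  then have inj: "inj_on \<phi> (H - {q})" using im finH by (intro eq_card_imp_inj_on) auto
  have "w \<in> X" if "w \<in> H" "w \<noteq> p" "w \<noteq> q" for w
  proof -
    have "z = w" if z: "z \<in> H" "\<phi> z = \<phi> w" for z
    proof (cases "z = q")
      case True
      then have "\<phi> p = \<phi> w" using z pq by simp
      then show ?thesis using inj_onD[OF inj, of p w] pq \<open>w \<in> H\<close> \<open>w \<noteq> q\<close> \<open>w \<noteq> p\<close> by auto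
    next
      case False
      then show ?thesis using inj_onD[OF inj, of z w] z \<open>w \<in> H\<close> \<open>w \<noteq> q\<close> by auto
    qed
    then show ?thesis using \<open>w \<in> H\<close> by (auto simp: X_def)
  qed
  moreover have "p \<notin> X" "q \<notin> X" using pq by (auto simp: X_def)
  ultimately have "H - X = {p, q}" using pq by auto
  then show ?thesis using that(2) pq c1 by blast
qed

lemma card_X: "k - 1 \<le> card X"
proof (cases rule: unique_or_pair)
  case 1
  then show ?thesis using all_colours finH card_image_le[of H \<phi>] by simp
next
  case (2 p q)
  have "card (H - X) = card H - card X" using XH finX by (simp add: card_Diff_subset)
  then show ?thesis using 2 by simp
qed

lemma inj_X: "inj_on \<phi> X" by (auto simp: X_def inj_on_def)


lemma card_rest: "card (H - X) \<le> 2"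
  by (cases rule: unique_or_pair) (auto simp: card_insert_if)

lemma card_colours_rest: "card (\<phi> ` (H - X)) \<le> 1"
proof (cases rule: unique_or_pair)
  case (2 p q)
  then have "\<phi> ` (H - X) = {\<phi> p}" by auto
  then show ?thesis by simp
qed simp

lemma phi_adj: "\<lbrakk>v \<in> H; w \<in> H; adj v w\<rbrakk> \<Longrightarrow> \<phi> v \<noteq> \<phi> w"
  using col irr unfolding proper_def H_def by fastforce

text \<open>
  Recolour \<open>y\<close> with the colour of \<open>x\<close> and let \<open>S\<close>, \<open>T\<close> be the resulting obstruction. Every fibre in \<open>S\<close>
  other than \<open>{x, y}\<close> permits its old colour, so these old colours and \<open>T\<close> are disjoint sets. Since
  \<open>card S + card T > k\<close>, this forces \<open>{x, y}\<close> into \<open>S\<close> and makes the two sets exhaust all colours;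
  the two colours lost from the list of fibres, \<open>\<phi> x\<close> and \<open>\<phi> y\<close>, must then lie in \<open>T\<close>. The vertices
  whose fibres are missing from \<open>S\<close> form \<open>E\<close>.
\<close>

lemma merge:
  assumes xX: "x \<in> X" and yX: "y \<in> X" and xy: "x \<noteq> y" and nadj: "\<not> adj x y"
  obtains T E where "\<phi> x \<in> T" "\<phi> y \<in> T" "finite T" "card T \<le> 3" "finite E" "card E + 2 \<le> card T"
    "\<And>w. w \<in> X - {x, y} - E \<Longrightarrow> T \<subseteq> F w"
proof -
  define \<rho> where "\<rho> = \<phi>(y := \<phi> x)"
  define P where "P c = {w \<in> H. \<rho> w = c}" for c
  have xH: "x \<in> H" and yH: "y \<in> H" using xX yX XH by auto
  have nadj': "\<not> adj y x" using nadj sym by blast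
  have phixy: "\<phi> x \<noteq> \<phi> y" using xX yH xy by (auto simp: X_def)
  have uniq: "\<phi> v \<noteq> \<phi> w" if "v \<in> H" "w \<in> X" "v \<noteq> w" for v w using that by (auto simp: X_def)
  obtain S T where ST: "S \<subseteq> {..<k} - {\<phi> y}" "T \<subseteq> {..<k}" "k < card S + card T"
    "\<And>c. c \<in> S \<Longrightarrow> T \<subseteq> \<Union>(F ` P c)"
  proof (rule blocked[of "\<phi> y" \<rho>, folded P_def])
    show "\<phi> y < k" using yH phi_less by blast
    show "\<rho> ` H \<subseteq> {..<k} - {\<phi> y}"
      using phi_less xH phixy uniq[OF _ yX] by (auto simp: \<rho>_def)
    show "\<rho> v \<noteq> \<rho> w" if "v \<in> H" "w \<in> H" "adj v w" for v w
    proof -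
      have "v = y \<Longrightarrow> w \<noteq> x" "w = y \<Longrightarrow> v \<noteq> x" using nadj nadj' that(3) by auto
      then show ?thesis
        using phi_adj[OF that] uniq[OF that(1) xX] uniq[OF that(2) xX] by (auto simp: \<rho>_def)
    qed
  qed blast
  have finS: "finite S" and finT: "finite T" using ST(1,2) finite_subset by blast+
  define S' where "S' = S - {\<phi> x}"
  have "S' \<inter> T = {}"
  proof (rule ccontr)
    assume "S' \<inter> T \<noteq> {}"
    then obtain c where c: "c \<in> S" "c \<noteq> \<phi> x" "c \<in> T" by (auto simp: S'_def)
    then obtain w where "w \<in> P c" "c \<in> F w" using ST(4) by blast
    then show False using c(2) phi_notin_F[of w] by (auto simp: P_def \<rho>_def split: if_splits)
  qed
  then have cU: "card (S' \<union> T) = card S' + card T"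
    using finS finT by (intro card_Un_disjoint) (auto simp: S'_def)
  have sub: "S' \<union> T \<subseteq> {..<k}" using ST(1,2) by (auto simp: S'_def)
  then have cle: "card S' + card T \<le> k" using cU card_mono[OF _ sub] by simp
  have xS: "\<phi> x \<in> S"
  proof (rule ccontr)
    assume "\<phi> x \<notin> S"
    then have "S' = S" by (auto simp: S'_def)
    then show False using cle ST(3) by simp
  qed
  then have "card S = card S' + 1" using card.remove[OF finS] by (simp add: S'_def)
  then have "card (S' \<union> T) = card {..<k}" using cU cle ST(3) by simp
  then have full: "S' \<union> T = {..<k}" using sub by (intro card_subset_eq) auto
  have xT: "\<phi> x \<in> T" using full phi_less[OF xH] by (auto simp: S'_def)
  have yT: "\<phi> y \<in> T" using full phi_less[OF yH] ST(1) by (auto simp: S'_def)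
  have single: "T \<subseteq> F w" if w: "w \<in> X - {x, y}" "\<phi> w \<in> S" for w
  proof -
    have "P (\<phi> w) = {w}" using w XH uniq[of _ w] uniq[of w x] xX by (auto simp: P_def \<rho>_def)
    then show ?thesis using ST(4)[OF w(2)] by simp
  qed
  \<comment> \<open>Otherwise \<open>S\<close> has at most two fibres, while the two vertices \<open>x\<close>, \<open>y\<close> forbid at most \<open>3 + 3\<close>
    colours; \<open>2 + 6 \<le> 8 \<le> k\<close> then contradicts \<open>k < card S + card T\<close>.\<close>
  have "\<exists>w \<in> X - {x, y}. \<phi> w \<in> S"
  proof (rule ccontr)
    assume none: "\<not> (\<exists>w \<in> X - {x, y}. \<phi> w \<in> S)"
    have "S \<subseteq> insert (\<phi> x) (\<phi> ` (H - X))"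
    proof
      fix c assume c: "c \<in> S"
      then have "c \<in> \<phi> ` H" using ST(1) all_colours by auto
      then obtain w where "w \<in> H" "c = \<phi> w" by auto
      then show "c \<in> insert (\<phi> x) (\<phi> ` (H - X))" using none c ST(1) by auto
    qed
    then have "card S \<le> card (insert (\<phi> x) (\<phi> ` (H - X)))" using finH by (intro card_mono) auto
    also have "\<dots> \<le> 2" using card_colours_rest finH by (simp add: card_insert_if)
    finally have S2: "card S \<le> 2" .
    have "P (\<phi> x) \<subseteq> {x, y}" using uniq[OF _ xX] by (auto simp: P_def \<rho>_def)
    then have "T \<subseteq> F x \<union> F y" using ST(4)[OF xS] by blast
    then have "card T \<le> card (F x \<union> F y)" using finF by (intro card_mono) auto
    also have "\<dots> \<le> 6" using card_Un_le[of "F x" "F y"] F_le_3[OF xH] F_le_3[OF yH] by simp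
    finally show False using S2 ST(3) k8 by simp
  qed
  then obtain w0 where w0: "w0 \<in> X" "T \<subseteq> F w0" using single by blast
  then have T3: "card T \<le> 3" using F_le_3[of w0] card_mono[OF finF w0(2)] XH by auto
  define E where "E = {w \<in> X - {x, y}. \<phi> w \<notin> S}"
  have finE: "finite E" using finX by (simp add: E_def)
  have "\<phi> ` E \<subseteq> {..<k} - {\<phi> y} - S" using phi_less XH uniq[OF _ yX] by (auto simp: E_def)
  then have "card (\<phi> ` E) \<le> card ({..<k} - {\<phi> y} - S)" by (intro card_mono) auto
  moreover have "card (\<phi> ` E) = card E"
    by (intro card_image inj_on_subset[OF inj_X]) (auto simp: E_def)
  moreover have "card ({..<k} - {\<phi> y} - S) = k - 1 - card S"
    using ST(1) finS phi_less[OF yH] by (simp add: card_Diff_subset)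
  moreover have "card S \<le> k - 1" using card_mono[OF _ ST(1)] phi_less[OF yH] by simp
  ultimately have "card E + 2 \<le> card T" using ST(3) k8 by linarith
  then show ?thesis using that[of T E] xT yT finT T3 finE single by (auto simp: E_def)
qed

lemma spread:
  assumes "x \<in> X" "y \<in> X" "x \<noteq> y" "\<not> adj x y"
  shows "\<exists>e. \<forall>w\<in>X - {x, y, e}. \<phi> x \<in> F w \<and> \<phi> y \<in> F w"
proof -
  obtain T E where TE: "\<phi> x \<in> T" "\<phi> y \<in> T" "card T \<le> 3" "finite E" "card E + 2 \<le> card T"
    "\<And>w. w \<in> X - {x, y} - E \<Longrightarrow> T \<subseteq> F w" using merge[OF assms] by metis
  have "card E \<le> 1" using TE by simp
  then obtain e where "E \<subseteq> {e}" using TE(4)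
    by (metis One_nat_def card_le_Suc0_iff_eq empty_subsetI insertI1 subsetI singletonD singletonI)
  then show ?thesis using TE by blast
qed

text \<open>
  Suppose that \<open>x\<close> and \<open>y\<close> are non-adjacent, and let \<open>R\<close> be the set of the other vertices
  of \<open>X\<close> outside \<open>E\<close>; they forbid all of \<open>T\<close>, which has two or three colours. The colour of a vertex of \<open>R\<close> is not in
  \<open>T\<close>. If a vertex of \<open>R\<close> had a non-neighbour in \<open>X\<close>, then by \<open>spread\<close> its own colour would be
  forbidden on nearly all of \<open>X\<close> as well, and some vertex of \<open>R\<close> would be denied four colours. With
  three colours in \<open>T\<close> this excludes every such non-neighbour. With two, it excludes non-neighbours in
  \<open>R\<close> and allows at most one vertex of \<open>R\<close> to miss \<open>x\<close> or \<open>y\<close>. Each remaining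
  vertex of \<open>R\<close> has at least \<open>card T\<close> non-neighbours in \<open>H\<close>, which are all found among the at most two vertices of \<open>H - X\<close>. That is
  impossible for \<open>card T = 3\<close>, and for \<open>card T = 2\<close> it gives a vertex of \<open>H - X\<close> four non-neighbours.
\<close>

lemma X_clique:
  assumes xX: "x \<in> X" and yX: "y \<in> X" and xy: "x \<noteq> y"
  shows "adj x y"
proof (rule ccontr)
  assume nadj: "\<not> adj x y"
  obtain T E where TE: "\<phi> x \<in> T" "\<phi> y \<in> T" "finite T" "card T \<le> 3" "finite E"
    "card E + 2 \<le> card T" "\<And>w. w \<in> X - {x, y} - E \<Longrightarrow> T \<subseteq> F w"
    using merge[OF xX yX xy nadj] by metis
  define R where "R = X - {x, y} - E"
  have RX: "R \<subseteq> X" and finR: "finite R" using finX by (auto simp: R_def)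
  have RXE: "R = X - ({x, y} \<union> E)" by (auto simp: R_def)
  have "card X - card ({x, y} \<union> E) \<le> card R"
    using diff_card_le_card_Diff[of "{x, y} \<union> E" X] TE(5) by (simp add: RXE)
  moreover have "card ({x, y} \<union> E) \<le> 2 + card E"
    using card_Un_le[of "{x, y}" E] xy by simp
  ultimately have cR: "5 \<le> card R + card E" using card_X k8 by linarith
  have pick: "\<exists>v\<in>R. v \<notin> B" if "finite B" "card B < card R" for B
    using that by (meson card_mono linorder_not_less subsetI)
  have TF: "T \<subseteq> F v" if "v \<in> R" for v using TE(7) that by (simp add: R_def)
  have no4: "card (T \<union> B) \<le> 3" if "v \<in> R" "B \<subseteq> F v" for v B
    using card_mono[OF finF, of "T \<union> B" v] F_le_3[of v] TF[OF that(1)] that RX XH by fastforce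
  have notT: "\<phi> w \<notin> T" if "w \<in> R" for w
    using TF[OF that] phi_notin_F[of w] that RX XH by blast
  have inM: "card T \<le> card (M w)" if "w \<in> R" for w
    using card_mono[OF finF TF[OF that]] F_le_M[of w] that RX XH by fastforce
  have "card T = 3 \<or> card T = 2" using TE(4,6) by linarith
  then show False
  proof
    assume T3: "card T = 3"
    then have cR4: "4 \<le> card R" using cR TE(6) by simp
    then obtain w where w: "w \<in> R" using pick[of "{}"] by auto
    have "adj w z" if z: "z \<in> X" "z \<noteq> w" for z
    proof (rule ccontr)
      assume "\<not> adj w z"
      then obtain e where e: "\<forall>v\<in>X - {w, z, e}. \<phi> w \<in> F v \<and> \<phi> z \<in> F v"
        using spread[of w z] w z RX by blast
      have "card {w, z, e} < card R" using cR4 by (simp add: card_insert_if)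
      then obtain v where v: "v \<in> R" "v \<notin> {w, z, e}" using pick[of "{w, z, e}"] by auto
      then have "card (T \<union> {\<phi> w}) \<le> 3" using e RX by (intro no4[OF v(1)]) auto
      then show False using T3 TE(3) notT[OF w] by simp
    qed
    then have "M w \<subseteq> H - X" by (auto simp: M_def)
    then have "card (M w) \<le> 2" using card_mono[of "H - X" "M w"] card_rest finH by simp
    then show False using inM[OF w] T3 by simp
  next
    assume T2: "card T = 2"
    then have "card E = 0" using TE(6) by simp
    then have E0: "E = {}" and cR5: "5 \<le> card R" using TE(5) cR by auto
    have clash: False if "v \<in> R" "w \<in> R" "z \<in> R" "w \<noteq> z" "\<phi> w \<in> F v" "\<phi> z \<in> F v" for v w z
    proof -
      have "\<phi> w \<noteq> \<phi> z" using that inj_onD[OF inj_X] RX by blast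
      moreover have "card (T \<union> {\<phi> w, \<phi> z}) \<le> 3" using that by (intro no4[OF that(1)]) auto
      ultimately show False using T2 TE(3) notT that by simp
    qed
    have adjR: "adj w z" if wz: "w \<in> R" "z \<in> R" "w \<noteq> z" for w z
    proof (rule ccontr)
      assume "\<not> adj w z"
      then obtain e where e: "\<forall>v\<in>X - {w, z, e}. \<phi> w \<in> F v \<and> \<phi> z \<in> F v"
        using spread[of w z] wz RX by blast
      have "card {w, z, e} < card R" using cR5 by (simp add: card_insert_if)
      then obtain v where v: "v \<in> R" "v \<notin> {w, z, e}" using pick[of "{w, z, e}"] by auto
      then show False using clash[OF v(1) wz] e RX by auto
    qed
    define bad where "bad w \<longleftrightarrow> w \<in> R \<and> (\<not> adj w x \<or> \<not> adj w y)" for w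
    have bad_spread: "\<exists>e. \<forall>v\<in>R - {w, e}. \<phi> w \<in> F v" if "bad w" for w
    proof -
      have "\<exists>z\<in>{x, y}. \<not> adj w z" using that by (auto simp: bad_def)
      moreover have "w \<in> R" using that by (simp add: bad_def)
      ultimately obtain z where z: "z \<in> {x, y}" "\<not> adj w z" "w \<in> R" by blast
      then obtain e where "\<forall>v\<in>X - {w, z, e}. \<phi> w \<in> F v \<and> \<phi> z \<in> F v"
        using spread[of w z] xX yX RX by (auto simp: R_def)
      then show ?thesis using z by (auto simp: R_def)
    qed
    have one_bad: "w1 = w2" if bad: "bad w1" "bad w2" for w1 w2
    proof (rule ccontr)
      assume ne: "w1 \<noteq> w2"
      obtain e1 e2 where e: "\<forall>v\<in>R - {w1, e1}. \<phi> w1 \<in> F v" "\<forall>v\<in>R - {w2, e2}. \<phi> w2 \<in> F v"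
        using bad_spread bad by metis
      have "card {w1, w2, e1, e2} < card R" using cR5 by (simp add: card_insert_if)
      then obtain v where v: "v \<in> R" "v \<notin> {w1, w2, e1, e2}"
        using pick[of "{w1, w2, e1, e2}"] by auto
      then show False using clash[OF v(1) _ _ ne] e bad by (auto simp: bad_def)
    qed
    obtain w0 where w0: "\<And>w. bad w \<Longrightarrow> w = w0" using one_bad by blast
    have Mw: "M w = H - X" "card (H - X) = 2" if w: "w \<in> R - {w0}" for w
    proof -
      have "\<not> bad w" using w0 w by blast
      then have "M w \<subseteq> H - X" using w adjR E0 by (auto simp: M_def bad_def R_def)
      moreover have "2 \<le> card (M w)" using inM w T2 by force
      moreover have "finite (H - X)" using finH by simp
      ultimately show "M w = H - X" "card (H - X) = 2"
        using card_rest card_mono[of "H - X" "M w"] card_subset_eq[of "H - X" "M w"] by auto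
    qed
    have c4: "4 \<le> card (R - {w0})" using cR5 diff_card_le_card_Diff[of "{w0}" R] by simp
    then obtain w where "w \<in> R - {w0}" by (metis card.empty all_not_in_conv not_numeral_le_zero)
    then have "H - X \<noteq> {}" using Mw(2)[of w] by (metis card.empty zero_neq_numeral)
    then obtain p where p: "p \<in> H" "p \<notin> X" by blast
    have "R - {w0} \<subseteq> M p"
    proof
      fix w assume w: "w \<in> R - {w0}"
      then have "p \<in> M w" using Mw p by blast
      then show "w \<in> M p" using w RX XH sym by (auto simp: M_def)
    qed
    then have "4 \<le> card (M p)" using c4 card_mono[OF finM, of "R - {w0}" p] by simp
    then show False using M_le_3[OF p(1)] by simp
  qed
qed

section \<open>A repeated colour\<close>

text \<open>
  Once \<open>X\<close> is a clique, a vertex of \<open>X\<close> has no non-neighbours in \<open>H\<close> besides \<open>p\<close> and \<open>q\<close>, so it forbids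
  at most two colours. Any single vertex in the obstruction thus makes it comprise all classes with
  exactly two colours, and all but at most two vertices of \<open>X\<close> would be non-adjacent to \<open>p\<close>. What
  remains are the merged classes alone, which do not forbid enough colours. If \<open>p\<close> and \<open>q\<close> are merged
  with the same vertex, three vertices with three forbidden colours each would be too many; the
  hypothesis for \<open>a = b\<close> lowers the count to \<open>2 + 3 + 2\<close>.
\<close>

lemma no_merge_with_pair:
  assumes pq: "p \<noteq> q" "p \<in> H" "q \<in> H" "\<phi> p = \<phi> q" "H - X = {p, q}"
    and aX: "a \<in> X" "\<not> adj p a" and bX: "b \<in> X" "\<not> adj q b"
    and only: "a = b \<Longrightarrow> M p \<subseteq> {q, a}"
  shows False
proof -
  define \<rho> where "\<rho> = \<phi>(p := \<phi> a, q := \<phi> b)"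
  define P where "P c = {w \<in> H. \<rho> w = c}" for c
  have npX: "p \<notin> X" "q \<notin> X" using pq by auto
  have HX: "w \<in> X" if "w \<in> H" "w \<noteq> p" "w \<noteq> q" for w using that pq(5) by blast
  have uniq: "\<phi> v \<noteq> \<phi> w" if "v \<in> H" "w \<in> X" "v \<noteq> w" for v w using that by (auto simp: X_def)
  have npq: "\<not> adj p q" using phi_adj pq by blast
  have MX: "M w \<subseteq> {p, q}" if "w \<in> X" for w
    using X_clique that pq(5) by (auto simp: M_def)
  have M2: "card (M w) \<le> 2" if "w \<in> X" for w
    using card_mono[OF _ MX[OF that]] pq(1) by simp
  obtain S T where ST: "S \<subseteq> {..<k} - {\<phi> p}" "T \<subseteq> {..<k}" "k < card S + card T"
    "\<And>c. c \<in> S \<Longrightarrow> T \<subseteq> \<Union>(F ` P c)"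
  proof (rule blocked[of "\<phi> p" \<rho>, folded P_def])
    show "\<phi> p < k" using pq phi_less by blast
    show "\<rho> ` H \<subseteq> {..<k} - {\<phi> p}"
    proof
      fix c assume "c \<in> \<rho> ` H"
      then obtain w where "w \<in> X" "c = \<phi> w" using HX aX bX by (auto simp: \<rho>_def split: if_splits)
      then show "c \<in> {..<k} - {\<phi> p}" using uniq[of p w] npX phi_less XH pq by auto
    qed
    have *: "\<rho> v \<noteq> \<rho> w" if "v \<in> H" "w \<in> H" "adj v w" "v = p \<or> v = q \<or> w \<noteq> p \<and> w \<noteq> q" for v w
    proof -
      have "v = p \<Longrightarrow> w \<noteq> p \<and> w \<noteq> q \<and> w \<noteq> a" "v = q \<Longrightarrow> w \<noteq> p \<and> w \<noteq> q \<and> w \<noteq> b"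
        using that(3) npq irr sym aX bX by auto
      then show ?thesis
        using phi_adj[OF that(1-3)] uniq[OF that(2) aX(1)] uniq[OF that(2) bX(1)] that(4)
        by (auto simp: \<rho>_def)
    qed
    show "\<rho> v \<noteq> \<rho> w" if "v \<in> H" "w \<in> H" "adj v w" for v w
      using *[of v w] *[of w v] that sym by metis
  qed blast
  have finS: "finite S" and finT: "finite T" using ST(1,2) finite_subset by blast+
  have cS: "card S \<le> k - 1" using card_mono[OF _ ST(1)] phi_less[OF pq(2)] by simp
  have single: "T \<subseteq> F w" if w: "w \<in> X - {a, b}" "\<phi> w \<in> S" for w
  proof -
    have "P (\<phi> w) = {w}"
      using w XH uniq[of _ w] aX bX npX by (auto simp: P_def \<rho>_def)
    then show ?thesis using ST(4)[OF w(2)] by simp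
  qed
  show False
  proof (cases "\<exists>w\<in>X - {a, b}. \<phi> w \<in> S")
    case True
    then obtain w where w: "w \<in> X" "T \<subseteq> F w" using single by blast
    then have "card T \<le> 2"
      using card_mono[OF finF w(2)] F_le_M[of w] M2[OF w(1)] XH by fastforce
    then have "card S = k - 1" and T2: "card T = 2" using ST(3) cS k8 by auto
    then have "S = {..<k} - {\<phi> p}"
      using ST(1) phi_less[OF pq(2)] by (intro card_subset_eq) auto
    then have "\<phi> v \<in> S" if "v \<in> X" for v using that XH phi_less uniq[of p v] npX pq by auto
    then have all: "T \<subseteq> F v" if "v \<in> X - {a, b}" for v using single that by blast
    have "X - {a, b} \<subseteq> M p"
    proof
      fix v assume v: "v \<in> X - {a, b}"
      then have "2 \<le> card (M v)"
        using T2 card_mono[OF finF all[OF v]] F_le_M[of v] XH by fastforce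
      then have "M v = {p, q}" using MX[of v] v pq(1) by (intro card_seteq) auto
      then have "p \<in> M v" by simp
      then show "v \<in> M p" using v XH sym[of p v] by (auto simp: M_def)
    qed
    then have "card (X - {a, b}) \<le> 3" using card_mono[OF finM] M_le_3[OF pq(2)] le_trans by blast
    moreover have "card X - 2 \<le> card (X - {a, b})"
      using diff_card_le_card_Diff[of "{a, b}" X] by (cases "a = b") (auto simp: card_insert_if)
    ultimately show False using card_X k8 by linarith
  next
    case False
    have "S \<subseteq> {\<phi> a, \<phi> b}"
    proof
      fix c assume c: "c \<in> S"
      then have "c \<in> \<phi> ` H" "c \<noteq> \<phi> p" using ST(1) all_colours by auto
      then obtain w where "w \<in> X" "c = \<phi> w" using HX pq(4) by auto
      then show "c \<in> {\<phi> a, \<phi> b}" using False c by auto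
    qed
    then have S2: "card S \<le> card {\<phi> a, \<phi> b}" by (intro card_mono) auto
    have "card T \<le> k" using card_mono[OF _ ST(2)] by simp
    then obtain c where c: "c \<in> S" using ST(3) by fastforce
    have aH: "a \<in> H" and bH: "b \<in> H" using aX bX XH by auto
    show False
    proof (cases "a = b")
      case False
      have "\<exists>v\<in>H. \<exists>w\<in>H. P c \<subseteq> {v, w}"
      proof (cases "c = \<phi> a")
        case True
        then have "P c \<subseteq> {p, a}" using uniq[of _ a] aX uniq[OF aH bX(1) False] by (auto simp: P_def \<rho>_def split: if_splits)
        then show ?thesis using aH pq by blast
      next
        case False
        then have "P c \<subseteq> {q, b}" using uniq[of _ b] bX c \<open>S \<subseteq> {\<phi> a, \<phi> b}\<close> by (auto simp: P_def \<rho>_def split: if_splits)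
        then show ?thesis using bH pq by blast
      qed
      then obtain v w where vw: "v \<in> H" "w \<in> H" "P c \<subseteq> {v, w}" by blast
      then have "T \<subseteq> F v \<union> F w" using ST(4)[OF c] by blast
      then have "card T \<le> card (F v \<union> F w)" using finF by (intro card_mono) auto
      also have "\<dots> \<le> 6" using card_Un_le[of "F v" "F w"] F_le_3[OF vw(1)] F_le_3[OF vw(2)] by simp
      finally show False using S2 ST(3) k8 by (simp add: card_insert_if split: if_splits)
    next
      case True
      then have "P c \<subseteq> {p, q, a}" using uniq[of _ a] aX c \<open>S \<subseteq> {\<phi> a, \<phi> b}\<close> by (auto simp: P_def \<rho>_def)
      then have "T \<subseteq> F p \<union> F q \<union> F a" using ST(4)[OF c] by blast
      then have "card T \<le> card (F p \<union> F q \<union> F a)" using finF by (intro card_mono) auto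
      also have "\<dots> \<le> card (F p) + card (F q) + card (F a)"
        using card_Un_le[of "F p \<union> F q" "F a"] card_Un_le[of "F p" "F q"] by simp
      also have "card (F p) \<le> 2"
        using F_le_M[OF pq(2)] card_mono[OF _ only[OF True]] by (simp add: card_insert_if split: if_splits)
      also have "card (F q) \<le> 3" using F_le_3 pq by blast
      also have "card (F a) \<le> 2" using F_le_M[OF aH] M2[OF aX(1)] by simp
      finally show False using S2 ST(3) k8 True by simp
    qed
  qed
qed

lemma u_adj: "w \<in> H \<Longrightarrow> adj u w" "w \<in> H \<Longrightarrow> adj w u"
  using sym by (auto simp: H_def)

lemma large_clique:
  "\<exists>K \<subseteq> V. card K = k + 1 \<and> (\<forall>v\<in>K. \<forall>w\<in>K. v \<noteq> w \<longrightarrow> adj v w)"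
proof (cases rule: unique_or_pair)
  case 1
  have "card H = k" using all_colours card_image[OF inj_X] 1 by simp
  then have "card (insert u H) = k + 1" using finH u_notin_H by simp
  moreover have "\<forall>v\<in>insert u H. \<forall>w\<in>insert u H. v \<noteq> w \<longrightarrow> adj v w"
    using X_clique u_adj unfolding 1 by blast
  moreover have "insert u H \<subseteq> V" using uV by (auto simp: H_def)
  ultimately show ?thesis by blast
next
  case (2 p q)
  have full: ?thesis if z: "z \<in> H - X" "\<forall>a\<in>X. adj z a" for z
  proof -
    have "card (H - X) = card H - card X" using XH finX by (simp add: card_Diff_subset)
    moreover have "card X \<le> card H" using XH finH card_mono by blast
    ultimately have "card X = k - 1" using 2 by simp
    then have size: "card (insert u (insert z X)) = k + 1"
      using finX XH u_notin_H z k8 by (auto simp: card_insert_if)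
    have za: "adj a z" if "a \<in> X" for a using z(2) that sym by blast
    have clique: "\<forall>v\<in>insert u (insert z X). \<forall>w\<in>insert u (insert z X). v \<noteq> w \<longrightarrow> adj v w"
      using X_clique z za u_adj XH by blast
    have "H \<subseteq> V" by (auto simp: H_def)
    then have "insert u (insert z X) \<subseteq> V" using uV z(1) XH by blast
    with size clique show ?thesis by (intro exI[of _ "insert u (insert z X)"] conjI)
  qed
  show ?thesis
  proof (rule ccontr)
    assume no: "\<not> ?thesis"
    have missed: "\<exists>a\<in>X. \<not> adj z a" if z: "z \<in> H - X" for z
    proof (rule ccontr)
      assume "\<not> (\<exists>a\<in>X. \<not> adj z a)"
      then have "\<forall>a\<in>X. adj z a" by blast
      from no full[OF z this] show False by (rule notE)
    qed
    have "p \<in> H - X" "q \<in> H - X" using 2 by auto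
    then obtain a b where a: "a \<in> X" "\<not> adj p a" and b: "b \<in> X" "\<not> adj q b"
      using missed by blast
    \<comment> \<open>Distinct partners are preferred; if \<open>p\<close> admits none other than \<open>b\<close>, then \<open>p\<close> misses only \<open>q\<close> and
      \<open>b\<close>, which is the extra hypothesis of \<open>no_merge_with_pair\<close>.\<close>
    show False
    proof (cases "\<exists>a'\<in>X. a' \<noteq> b \<and> \<not> adj p a'")
      case True
      then obtain a' where a': "a' \<in> X" "a' \<noteq> b" "\<not> adj p a'" by blast
      show False by (rule no_merge_with_pair[OF 2(1-5) a'(1,3) b]) (use a' in blast)
    next
      case False
      then have "M p \<subseteq> {q, b}" using 2 by (auto simp: M_def)
      moreover have "a = b" using False a by blast
      ultimately show False by (intro no_merge_with_pair[OF 2(1-5) a b]) simp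
    qed
  qed
qed

end

section \<open>Induction on the vertex set\<close>

text \<open>
  Choosing \<open>u\<close> of maximum degree lets one argument treat degree \<open>k + 1\<close> and degree \<open>k\<close> together; the
  case of maximum degree \<open>k\<close> is Brooks' theorem for the graphs considered.
\<close>

theorem colourable:
  assumes fin: "finite V"
    and sym: "\<And>v w. adj v w \<Longrightarrow> adj w v" and irr: "\<And>v. \<not> adj v v"
    and k8: "8 \<le> k"
    and deg: "\<And>v. v \<in> V \<Longrightarrow> card {w \<in> V. adj v w} \<le> k + 1"
    and cliques: "\<And>K. K \<subseteq> V \<Longrightarrow> (\<forall>v\<in>K. \<forall>w\<in>K. v \<noteq> w \<longrightarrow> adj v w) \<Longrightarrow> card K \<le> k"
    and codeg: "\<And>u v. u \<in> V \<Longrightarrow> v \<in> V \<Longrightarrow> adj u v \<Longrightarrow>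
      card {w \<in> V. adj u w \<and> w \<noteq> v \<and> \<not> adj v w} \<le> 3"
  shows "\<exists>c. proper adj V k c"
  using fin deg cliques codeg
proof (induction V rule: finite_psubset_induct)
  case (psubset V)
  show ?case
  proof (cases "V = {}")
    case True
    then show ?thesis by (simp add: proper_def)
  next
    case False
    define d where "d v = card {w \<in> V. adj v w}" for v
    have "Max (d ` V) \<in> d ` V" using False psubset.hyps by (intro Max_in) auto
    then obtain u where u: "u \<in> V" "d u = Max (d ` V)" by auto
    have max: "d w \<le> d u" if "w \<in> V" for w using u that psubset.hyps by simp
    have mono: "card {w \<in> V - {u}. Q w} \<le> card {w \<in> V. Q w}" for Q
      using psubset.hyps by (intro card_mono) auto
    have "\<exists>c. proper adj (V - {u}) k c"
    proof (rule psubset.IH)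
      show "V - {u} \<subset> V" using u by blast
      show "card {w \<in> V - {u}. adj v w} \<le> k + 1" if "v \<in> V - {u}" for v
        using le_trans[OF mono psubset.prems(1)] that by blast
      show "card K \<le> k" if "K \<subseteq> V - {u}" "\<forall>v\<in>K. \<forall>w\<in>K. v \<noteq> w \<longrightarrow> adj v w" for K
        using psubset.prems(2) that by blast
      show "card {w \<in> V - {u}. adj x w \<and> w \<noteq> v \<and> \<not> adj v w} \<le> 3"
        if "x \<in> V - {u}" "v \<in> V - {u}" "adj x v" for x v
        using le_trans[OF mono psubset.prems(3)] that by blast
    qed
    then obtain \<phi> where \<phi>: "proper adj (V - {u}) k \<phi>" by blast
    show ?thesis
    proof (rule ccontr)
      assume "\<nexists>c. proper adj V k c"
      then interpret stuck_vertex adj V u k \<phi>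
      proof unfold_locales
        show "card {v \<in> V. adj u v} \<le> k + 1" using psubset.prems(1) u(1) by blast
        show "card {v \<in> V. adj w v} \<le> card {v \<in> V. adj u v}" if "w \<in> V" for w
          using max[OF that] by (simp add: d_def)
      qed (use psubset.hyps psubset.prems(3) sym irr k8 u(1) \<phi> in blast)+
      show False using large_clique psubset.prems(2) by fastforce
    qed
  qed
qed

section \<open>The chromatic number\<close>

theorem mainTheorem1:
  fixes G :: "'a pair_pre_digraph"
  assumes "pair_graph G"
    and "max_degree G \<ge> 9"
    and "\<And>u v. u \<in> pverts G \<Longrightarrow> v \<in> nbhd G u \<Longrightarrow>
           card {w \<in> nbhd G u. w \<noteq> v \<and> (v, w) \<notin> parcs G} \<le> 3"
  shows "chromatic_number G \<le> max (max_degree G - 1) (clique_number G)"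
proof -
  interpret pair_graph G by fact
  define k where "k = max (max_degree G - 1) (clique_number G)"
  define adj where "adj v w \<longleftrightarrow> (v, w) \<in> parcs G" for v w
  have "\<exists>c. proper adj (pverts G) k c"
  proof (rule colourable)
    show "finite (pverts G)" by simp
    show "adj w v" if "adj v w" for v w using that arcs_symmetric by (simp add: adj_def)
    show "\<not> adj v v" for v using pair_no_loops[of "(v, v)"] by (auto simp: adj_def)
    show "8 \<le> k" using assms(2) by (simp add: k_def)
    show "card {w \<in> pverts G. adj v w} \<le> k + 1" if "v \<in> pverts G" for v
    proof -
      have "degree G v \<le> max_degree G" using max_degree_witness(2)[OF assms(1)] that by blast
      then have "card {w \<in> pverts G. adj v w} \<le> max_degree G"
        by (simp add: degree_def nbhd_def adj_def)
      then show ?thesis unfolding k_def by linarith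
    qed
    show "card K \<le> k" if "K \<subseteq> pverts G" "\<forall>v\<in>K. \<forall>w\<in>K. v \<noteq> w \<longrightarrow> adj v w" for K
      using clique_number_witness(2)[OF assms(1), of K] that by (auto simp: k_def is_clique_def adj_def)
    show "card {w \<in> pverts G. adj u w \<and> w \<noteq> v \<and> \<not> adj v w} \<le> 3"
      if "u \<in> pverts G" "v \<in> pverts G" "adj u v" for u v
      using assms(3)[of u v] that by (simp add: nbhd_def adj_def conj_assoc)
  qed
  then obtain c where "proper adj (pverts G) k c" by blast
  then have "is_coloring G k c"
    using in_arcsD1 in_arcsD2 by (auto simp: is_coloring_def proper_def adj_def)
  then show ?thesis using chromatic_number_witness(2)[OF assms(1)] by (simp add: k_def)
qed

end
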